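(* Let $X$ be an $r$-regular graph that has a dominatable partition with $s$ parts. Then $-1$ is an eigenvalue of the adjacency matrix of $X$ with multiplicity at least $s-1$.
   Context: A partition of $V(X)$ into cells $C_1,\ldots,C_s$ is equitable if for all $i,l$ the number $b_{il}$ of neighbours in $C_l$ of a vertex $u\in C_i$ depends only on $i$ and $l$ (not on $u$). A dominatable partition is an equitable partition $C_1,\ldots,C_s$ such that for each $1\leq l\leq s$ there is a value $a_l$ with $b_{il}=a_l$ for all $i\neq l$ and $b_{ll}=a_l-1$; i.e., every vertex outside $C_l$ has exactly $a_l$ neighbours in $C_l$ and every vertex in $C_l$ has exactly $a_l-1$ neighbours in $C_l$. *)

theory Defs
  imports
    "Graph_Theory.Digraph"
    "Jordan_Normal_Form.Char_Poly"
    "Jordan_Normal_Form.Matrix_Kernel"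
    "HOL-Library.Disjoint_Sets"
begin

text \<open>A finite simple graph is a symmetric, loop-free digraph without multiple arcs, i.e. an
  instance of the locale \<^locale>\<open>graph\<close>: each undirected edge is a pair of opposite arcs, so the
  degree of a vertex is its \<^const>\<open>out_degree\<close>.\<close>

definition regular_graph :: "nat \<Rightarrow> ('a, 'b) pre_digraph \<Rightarrow> bool" where
  "regular_graph r X \<longleftrightarrow> graph X \<and> (\<forall>v \<in> verts X. out_degree X v = r)"

definition nbrs_in :: "('a, 'b) pre_digraph \<Rightarrow> 'a \<Rightarrow> 'a set \<Rightarrow> nat" where
  "nbrs_in X u D = card {v \<in> D. u \<rightarrow>\<^bsub>X\<^esub> v}"

definition equitable_partition :: "('a, 'b) pre_digraph \<Rightarrow> 'a set set \<Rightarrow> bool" where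
  "equitable_partition X P \<longleftrightarrow>
     partition_on (verts X) P \<and>
     (\<forall>C \<in> P. \<forall>D \<in> P. \<exists>b. \<forall>u \<in> C. nbrs_in X u D = b)"

text \<open>The value \<open>a\<close> is an integer so that \<open>a - 1\<close> is not truncated.\<close>

definition dominatable_partition :: "('a, 'b) pre_digraph \<Rightarrow> 'a set set \<Rightarrow> bool" where
  "dominatable_partition X P \<longleftrightarrow>
     equitable_partition X P \<and>
     (\<forall>D \<in> P. \<exists>a :: int. \<forall>C \<in> P. \<forall>u \<in> C.
        int (nbrs_in X u D) = (if C = D then a - 1 else a))"

text \<open>Rows and columns are indexed by positions in the list \<open>vs\<close>, which is meant to enumerate the
  vertices without repetition.\<close>

definition adjacency_mat :: "('a, 'b) pre_digraph \<Rightarrow> 'a list \<Rightarrow> real mat" where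
  "adjacency_mat X vs =
     mat (length vs) (length vs) (\<lambda>(i, j). if vs ! i \<rightarrow>\<^bsub>X\<^esub> vs ! j then 1 else 0)"

end

theory Submission
  imports Defs
begin

text \<open>Write \<open>A\<close> for the adjacency matrix. Domination says that \<open>(A + I) \<chi>\<^sub>D = a\<^sub>D \<one>\<close> for the
  indicator vector of every cell \<open>D\<close>, and \<open>a\<^sub>D \<ge> 1\<close> because a vertex of \<open>D\<close> has \<open>a\<^sub>D - 1\<close>
  neighbours in \<open>D\<close>. Fixing a cell \<open>E\<close>, the \<open>s - 1\<close> vectors \<open>\<chi>\<^sub>D - (a\<^sub>D / a\<^sub>E) \<chi>\<^sub>E\<close> with \<open>D \<noteq> E\<close> are
  linearly independent elements of the kernel of \<open>A + I\<close>. The algebraic multiplicity is at least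
  the geometric one: if an invertible \<open>P\<close> brings \<open>A - e I\<close> into row echelon form, each zero row
  of \<open>P (A - e I)\<close> becomes a row of \<open>P (x I - A)\<close> that is divisible by \<open>x - e\<close>.\<close>

section \<open>Geometric and algebraic multiplicity\<close>

text \<open>Each term of the Leibniz expansion takes exactly one factor from every row, hence
  \<open>card Z\<close> factors that are multiples of \<open>q\<close>.\<close>

lemma power_dvd_det_if_rows_dvd:
  fixes M :: "'a :: comm_ring_1 mat"
  assumes M: "M \<in> carrier_mat n n" and Z: "Z \<subseteq> {0..<n}"
    and dvd: "\<And>i j. i \<in> Z \<Longrightarrow> j < n \<Longrightarrow> q dvd M $$ (i, j)"
  shows "q ^ card Z dvd det M"
  unfolding det_def'[OF M]
proof (intro dvd_sum dvd_mult)
  fix p assume "p \<in> {p. p permutes {0..<n}}"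
  then have p: "p i < n" if "i < n" for i
    using that permutes_in_image[of p "{0..<n}" i] by auto
  have "q ^ card Z = (\<Prod>i\<in>Z. q)" by simp
  also have "\<dots> dvd (\<Prod>i\<in>Z. M $$ (i, p i))"
    using Z p dvd by (intro prod_dvd_prod) auto
  also have "\<dots> dvd (\<Prod>i = 0..<n. M $$ (i, p i))"
    using Z by (intro prod_dvd_prod_subset) auto
  finally show "q ^ card Z dvd (\<Prod>i = 0..<n. M $$ (i, p i))" .
qed

lemma kernel_dim_char_matrix_le_order:
  fixes A :: "'a :: field mat"
  assumes A: "A \<in> carrier_mat n n"
  shows "kernel_dim (char_matrix A e) \<le> Polynomial.order e (char_poly A)"
proof -
  define C where "C = char_matrix A e"
  have C: "C \<in> carrier_mat n n" using A by (simp add: C_def)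
  obtain R where gj: "gauss_jordan_single C = R" by auto
  note R = gauss_jordan_single[OF C gj]
  obtain P Q where RPC: "R = P * C" and P: "P \<in> carrier_mat n n" and Q: "Q \<in> carrier_mat n n"
    and PQ: "P * Q = 1\<^sub>m n" and QP: "Q * P = 1\<^sub>m n"
    using R(4) by blast
  define Z where "Z = {i. i < n \<and> row R i = 0\<^sub>v n}"
  have Zn: "Z \<subseteq> {0..<n}" by (auto simp: Z_def)
  \<comment> \<open>Left multiplication by the invertible \<open>P\<close> preserves the kernel, so
    the nullity can be read off the zero rows of the echelon form \<open>R\<close>.\<close>
  have "kernel_dim C = kernel.dim n R"
    using mat_kernel_mult_eq[OF C P Q QP] C unfolding kernel_dim_def RPC by simp
  also have "\<dots> = n - card {i. i < n \<and> row R i \<noteq> 0\<^sub>v n}"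
    by (rule find_base_vectors(6)[OF R(3) R(2)])
  also have "{i. i < n \<and> row R i \<noteq> 0\<^sub>v n} = {0..<n} - Z" by (auto simp: Z_def)
  also have "n - card ({0..<n} - Z) = card Z"
    using card_Diff_subset[OF finite_subset[OF Zn] Zn] card_mono[OF _ Zn] by auto
  finally have dim: "kernel_dim C = card Z" .

  interpret coeff_lift_hom: comm_ring_hom "\<lambda>a :: 'a. [:a:]"
    by unfold_locales (auto simp: one_pCons)
  define M where "M = map_mat (\<lambda>a. [:a:]) P * char_poly_matrix A"
  have X: "char_poly_matrix A \<in> carrier_mat n n" using A by simp
  have P': "map_mat (\<lambda>a. [:a:]) P \<in> carrier_mat n n" using P by simp
  have M: "M \<in> carrier_mat n n" unfolding M_def using P' X by (rule mult_carrier_mat)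
  have "[:-e, 1:] ^ card Z dvd det M"
  proof (rule power_dvd_det_if_rows_dvd[OF M Zn])
    fix i j assume i: "i \<in> Z" and j: "j < n"
    then have i': "i < n" and "row R i = 0\<^sub>v n" by (auto simp: Z_def)
    then have "R $$ (i, j) = 0" using j R(2) by (metis carrier_matD index_row(1) index_zero_vec(1))
    then have 0: "(\<Sum>k = 0..<n. P $$ (i, k) * C $$ (k, j)) = 0"
      using i' j P C by (simp add: RPC scalar_prod_def)
    \<comment> \<open>Since \<open>C\<close> is A - e I, we have x I - A = (x - e) I - C. Multiplied
      by \<open>P\<close>, the second summand becomes \<open>R\<close>, whose row \<open>i\<close>
      vanishes; only (x - e) times row \<open>i\<close> of \<open>P\<close> survives.\<close>
    have entry: "char_poly_matrix A $$ (k, j) = (if k = j then [:-e, 1:] else 0) - [:C $$ (k, j):]"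
      if "k < n" for k
      using that j A by (auto simp: char_poly_matrix_def C_def char_matrix_def)
    have "M $$ (i, j) = (\<Sum>k = 0..<n. [:P $$ (i, k):] * char_poly_matrix A $$ (k, j))"
      using i' j P X by (simp add: M_def scalar_prod_def)
    also have "\<dots> = (\<Sum>k = 0..<n. (if k = j then [:P $$ (i, k):] * [:-e, 1:] else 0)
        - [:P $$ (i, k) * C $$ (k, j):])"
      by (intro sum.cong refl) (auto simp: entry algebra_simps)
    also have "\<dots> = [:P $$ (i, j):] * [:-e, 1:] - (\<Sum>k = 0..<n. [:P $$ (i, k) * C $$ (k, j):])"
      using j by (simp add: sum_subtractf)
    also have "(\<Sum>k = 0..<n. [:P $$ (i, k) * C $$ (k, j):]) = 0"
      using 0 by (simp flip: coeff_lift_hom.hom_sum)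
    finally show "[:-e, 1:] dvd M $$ (i, j)" by (metis diff_zero dvd_triv_right)
  qed
  moreover have "det M = [:det P:] * char_poly A"
    unfolding M_def char_poly_def using det_mult[OF P' X] coeff_lift_hom.hom_det[of P] by simp
  \<comment> \<open>Hence \<open>det P\<close> is a unit as a constant polynomial, and a power
    dividing \<open>det M\<close> divides \<open>char_poly A\<close>.\<close>
  moreover have "det P \<noteq> 0"
    using det_mult[OF P Q] PQ by auto
  ultimately have "[:-e, 1:] ^ card Z dvd char_poly A"
    by (simp add: dvd_smult_cancel)
  moreover have "char_poly A \<noteq> 0"
    using degree_monic_char_poly[OF A] by auto
  ultimately show ?thesis
    unfolding C_def[symmetric] dim by (intro order_max)
qed

text \<open>The coordinate functionals at the positions \<open>k j\<close> are dual to the vectors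
  \<open>w i\<close>: evaluating a linear combination at \<open>k j\<close> isolates the coefficient
  of \<open>w j\<close>, which gives independence.\<close>

lemma card_le_kernel_dim:
  fixes A :: "'a :: field mat"
  assumes A: "A \<in> carrier_mat nr nc" and I: "finite I"
    and w: "\<And>i. i \<in> I \<Longrightarrow> w i \<in> mat_kernel A"
    and k: "\<And>i. i \<in> I \<Longrightarrow> k i < nc"
    and dual: "\<And>i j. i \<in> I \<Longrightarrow> j \<in> I \<Longrightarrow> w i $ k j = (if i = j then 1 else 0)"
  shows "card I \<le> kernel_dim A"
proof -
  interpret kernel nr nc A by unfold_locales (rule A)
  have inj: "inj_on w I"
    by (rule inj_onI) (metis dual zero_neq_one)
  have sub: "w ` I \<subseteq> mat_kernel A" using w by auto
  have "lin_indpt (w ` I)"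
  proof (rule Ker.finite_lin_indpt2)
    show "finite (w ` I)" using I by simp
    show "w ` I \<subseteq> mat_kernel A" by (rule sub)
    fix c assume 0: "lincomb c (w ` I) = 0\<^sub>v nc"
    have "c (w j) = 0" if j: "j \<in> I" for j
    proof -
      have "0 = lincomb c (w ` I) $ k j" using 0 k[OF j] by simp
      also have "\<dots> = (\<Sum>i\<in>I. c (w i) * w i $ k j)"
        by (simp add: lincomb_index[OF k[OF j] sub] sum.reindex[OF inj])
      also have "\<dots> = (\<Sum>i\<in>I. if i = j then c (w i) else 0)"
        by (intro sum.cong) (auto simp: dual j)
      also have "\<dots> = c (w j)" using I j by simp
      finally show ?thesis by simp
    qed
    then show "\<forall>v\<in>w ` I. c v = 0" by auto
  qed
  moreover have "Ker.fin_dim"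
    using kernel_basis_exists[OF A] unfolding Ker.fin_dim_def Ker.basis_def by auto
  ultimately have "card (w ` I) \<le> dim"
    using Ker.li_le_dim(2) sub by blast
  then show ?thesis by (simp add: card_image[OF inj])
qed

section \<open>Dominatable partitions\<close>

lemma adjacency_mat_carrier: "adjacency_mat X vs \<in> carrier_mat (length vs) (length vs)"
  by (simp add: adjacency_mat_def)

text \<open>For A the adjacency matrix, the char matrix at -1 is A + I: A counts the neighbours in
  \<open>D\<close>, and I contributes the vertex itself.\<close>

lemma char_matrix_adjacency_mult_indicator:
  assumes vs: "distinct vs" and D: "D \<subseteq> set vs" and i: "i < length vs"
  shows "(char_matrix (adjacency_mat X vs) (- 1) *\<^sub>v vec (length vs) (\<lambda>j. of_bool (vs ! j \<in> D))) $ i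
    = real (nbrs_in X (vs ! i) D) + of_bool (vs ! i \<in> D)"
proof -
  let ?n = "length vs"
  let ?adj = "\<lambda>v. vs ! i \<rightarrow>\<^bsub>X\<^esub> v"
  have "(char_matrix (adjacency_mat X vs) (- 1) *\<^sub>v vec ?n (\<lambda>j. of_bool (vs ! j \<in> D))) $ i
    = (\<Sum>j = 0..<?n. (of_bool (?adj (vs ! j)) + of_bool (i = j)) * of_bool (vs ! j \<in> D))"
    using i unfolding char_matrix_def adjacency_mat_def
    by (auto simp: scalar_prod_def simp del: sum_mult_of_bool_eq intro!: sum.cong)
  also have "\<dots> = (\<Sum>j = 0..<?n. of_bool (?adj (vs ! j)) * of_bool (vs ! j \<in> D))
      + (\<Sum>j = 0..<?n. if i = j then of_bool (vs ! j \<in> D) else 0)"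
    unfolding sum.distrib[symmetric] by (intro sum.cong) (auto simp: algebra_simps)
  also have "(\<Sum>j = 0..<?n. if i = j then of_bool (vs ! j \<in> D) else 0) = (of_bool (vs ! i \<in> D) :: real)"
    using i by simp
  also have "(\<Sum>j = 0..<?n. of_bool (?adj (vs ! j)) * of_bool (vs ! j \<in> D))
      = (\<Sum>v\<in>set vs. of_bool (?adj v) * of_bool (v \<in> D) :: real)"
    using sum.reindex_bij_betw[OF bij_betw_nth[OF vs, of "{0..<?n}" "set vs"],
        of "\<lambda>v. of_bool (?adj v) * of_bool (v \<in> D) :: real"]
    by (simp add: atLeast0LessThan)
  also have "\<dots> = (\<Sum>v\<in>set vs. if v \<in> {v \<in> D. ?adj v} then 1 else 0)"
    by (intro sum.cong) auto
  also have "\<dots> = real (nbrs_in X (vs ! i) D)"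
    using D by (subst sum.inter_restrict[symmetric]) (auto simp: nbrs_in_def Int_absorb1 subset_iff intro!: arg_cong[where f = card])
  finally show ?thesis .
qed

lemma card_le_kernel_dim_adjacency_mat:
  assumes P: "dominatable_partition X P" and vs: "distinct vs" "set vs = verts X"
  shows "card P - 1 \<le> kernel_dim (char_matrix (adjacency_mat X vs) (- 1))"
\<comment> \<open>Without a cell there is no reference cell \<open>E\<close>, but then truncated
  subtraction makes the bound 0.\<close>
proof (cases "P = {}")
  case False
  then obtain E where E: "E \<in> P" by blast
  let ?n = "length vs"
  let ?C = "char_matrix (adjacency_mat X vs) (- 1)"
  have C: "?C \<in> carrier_mat ?n ?n" by (simp add: adjacency_mat_carrier)
  have part: "partition_on (set vs) P"
    using P vs by (simp add: dominatable_partition_def equitable_partition_def)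
  have sub: "D \<subseteq> set vs" and ne: "D \<noteq> {}" if "D \<in> P" for D
    using part that by (auto simp: partition_on_def)
  have disj: "D = D'" if "D \<in> P" "D' \<in> P" "v \<in> D" "v \<in> D'" for D D' v
    using part that by (auto simp: partition_on_def disjoint_def)
  have finP: "finite P"
    using part by (rule finite_elements[rotated]) simp
  obtain a :: "'a set \<Rightarrow> int" where a: "\<And>D D' u. D \<in> P \<Longrightarrow> D' \<in> P \<Longrightarrow> u \<in> D' \<Longrightarrow>
      int (nbrs_in X u D) = (if D' = D then a D - 1 else a D)"
    using P unfolding dominatable_partition_def by metis
  have a_pos: "a E \<ge> 1"
  proof -
    obtain u where "u \<in> E" using ne[OF E] by blast
    from a[OF E E this] show ?thesis by simp
  qed
  define \<chi> where "\<chi> D = vec ?n (\<lambda>j. of_bool (vs ! j \<in> D) :: real)" for D :: "'a set"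
  have \<chi>: "?C *\<^sub>v \<chi> D = vec ?n (\<lambda>_. real_of_int (a D))" if D: "D \<in> P" for D
  proof (rule eq_vecI)
    fix i assume "i < dim_vec (vec ?n (\<lambda>_. real_of_int (a D)))"
    then have i: "i < ?n" by simp
    then have "vs ! i \<in> \<Union> P" using part by (simp add: partition_on_def)
    then obtain D' where D': "D' \<in> P" "vs ! i \<in> D'" by blast
    \<comment> \<open>The deficit of 1 inside \<open>D\<close> is exactly what the identity summand
      restores.\<close>
    have "real_of_int (int (nbrs_in X (vs ! i) D)) + of_bool (vs ! i \<in> D) = real_of_int (a D)"
      unfolding a[OF D D'] using disj[OF D D'(1) _ D'(2)] D'(2) by auto
    then show "(?C *\<^sub>v \<chi> D) $ i = vec ?n (\<lambda>_. real_of_int (a D)) $ i"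
      using char_matrix_adjacency_mult_indicator[OF vs(1) sub[OF D] i, of X] i
      by (simp add: \<chi>_def)
  qed (use C in simp)
  \<comment> \<open>Both indicators are sent to multiples of the all-ones vector; the ratio makes
    the images cancel.\<close>
  define w where "w D = \<chi> D - (a D / a E) \<cdot>\<^sub>v \<chi> E" for D
  \<comment> \<open>One representative position per cell supplies the dual coordinates: at the
    position chosen for a cell other than \<open>E\<close>, the \<chi> E part of each
    \<open>w D\<close> vanishes.\<close>
  have "\<exists>j < ?n. vs ! j \<in> D" if "D \<in> P" for D
    using sub[OF that] ne[OF that] by (metis all_not_in_conv in_set_conv_nth subsetD)
  then obtain k where k: "\<And>D. D \<in> P \<Longrightarrow> k D < ?n" "\<And>D. D \<in> P \<Longrightarrow> vs ! k D \<in> D"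
    by metis
  have "card (P - {E}) \<le> kernel_dim ?C"
  proof (rule card_le_kernel_dim[OF C])
    fix D assume D: "D \<in> P - {E}"
    have carr: "\<chi> D \<in> carrier_vec ?n" for D by (simp add: \<chi>_def)
    have "?C *\<^sub>v w D = ?C *\<^sub>v \<chi> D - (a D / a E) \<cdot>\<^sub>v (?C *\<^sub>v \<chi> E)"
      unfolding w_def using C carr
      by (simp add: mult_minus_distrib_mat_vec[OF C] mult_mat_vec[OF C])
    also have "\<dots> = 0\<^sub>v ?n" using D E a_pos by (auto simp: \<chi>)
    finally show "w D \<in> mat_kernel ?C"
      using carr by (intro mat_kernelI[OF C]) (auto simp: w_def)
  next
    fix D D' assume D: "D \<in> P - {E}" "D' \<in> P - {E}"
    then have "vs ! k D' \<notin> E" "vs ! k D' \<in> D \<longleftrightarrow> D = D'"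
      using k E disj by blast+
    then show "w D $ k D' = (if D = D' then 1 else 0)"
      using k D by (simp add: w_def \<chi>_def)
  qed (use finP k in auto)
  then show ?thesis using E finP by simp
qed simp

theorem theorem4p1:
  fixes X :: "('a, 'b) pre_digraph" and r s :: nat and P :: "'a set set" and vs :: "'a list"
  assumes "regular_graph r X"
    and "dominatable_partition X P" and "card P = s"
    and "distinct vs" and "set vs = verts X"
  shows "(s \<ge> 2 \<longrightarrow> eigenvalue (adjacency_mat X vs) (- 1)) \<and>
         Polynomial.order (- 1) (char_poly (adjacency_mat X vs)) \<ge> s - 1 \<and>
         kernel_dim (char_matrix (adjacency_mat X vs) (- 1)) \<ge> s - 1"
proof -
  let ?A = "adjacency_mat X vs"
  have geom: "s - 1 \<le> kernel_dim (char_matrix ?A (- 1))"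
    using card_le_kernel_dim_adjacency_mat assms by metis
  have alg: "s - 1 \<le> Polynomial.order (- 1) (char_poly ?A)"
    using geom kernel_dim_char_matrix_le_order[OF adjacency_mat_carrier] by (rule order_trans)
  \<comment> \<open>Here \<open>s - 1\<close> is positive, so the order is nonzero and -1 is a
    root.\<close>
  have "eigenvalue ?A (- 1)" if "s \<ge> 2"
    using that alg unfolding eigenvalue_root_char_poly[OF adjacency_mat_carrier]
    by (auto simp: order_root)
  with geom alg show ?thesis by blast
qed

end
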